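(* A function $f\in\mathcal HL_0(\mathbb D)$ attains its norm as a functional on $\mathcal G_0(\mathbb D)$ if and only if $f'\in\mathcal H^\infty(\mathbb D)$ attains its norm as a functional on $\mathcal G^\infty(\mathbb D)$.
   Context: $\mathbb D$ is the open unit disc in $\mathbb C$. $\mathcal HL_0(\mathbb D)$ is the Banach space of holomorphic Lipschitz functions $f:\mathbb D\to\mathbb C$ with $f(0)=0$, normed by the Lipschitz constant $L(f)$. $\mathcal H^\infty(\mathbb D)$ is the Banach space of bounded holomorphic functions on $\mathbb D$ with the supremum norm. For $E=\mathcal HL_0(\mathbb D)$ or $E=\mathcal H^\infty(\mathbb D)$, the canonical predual, denoted $\mathcal G_0(\mathbb D)$ or $\mathcal G^\infty(\mathbb D)$ respectively, is the set of $\varphi\in E^*$ whose restriction to the closed unit ball of $E$ is continuous for the compact-open topology (uniform convergence on compact subsets of $\mathbb D$), with the norm of $E^*$. By the Dixmier-Ng theorem the dual of this predual is $E$ isometrically, $f\in E$ acting by $\varphi\mapsto\varphi(f)$. A functional $f$ on a Banach space $G$ attains its norm if $|f(\varphi)|=\|f\|$ for some $\varphi$ in the closed unit ball of $G$. *)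

theory Defs
  imports "HOL-Complex_Analysis.Complex_Analysis"
begin

abbreviation disc :: "complex set" (\<open>\<bbbD>\<close>)
  where "\<bbbD> \<equiv> ball 0 1"

(* A function on the disc is represented by its extension by 0 to the complex plane, so that
   equality in HOL is equality on the disc.  These representatives are closed under pointwise
   vector space operations. *)

definition HL0 :: "(complex \<Rightarrow> complex) set" where
  "HL0 = {f. f holomorphic_on \<bbbD> \<and> (\<exists>C. C-lipschitz_on \<bbbD> f) \<and> f 0 = 0 \<and> (\<forall>z. z \<notin> \<bbbD> \<longrightarrow> f z = 0)}"

definition lip_const :: "(complex \<Rightarrow> complex) \<Rightarrow> real" where
  "lip_const f = (SUP (z, w) \<in> {(z, w). z \<in> \<bbbD> \<and> w \<in> \<bbbD> \<and> z \<noteq> w}. norm (f z - f w) / norm (z - w))"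

definition Hinf :: "(complex \<Rightarrow> complex) set" where
  "Hinf = {f. f holomorphic_on \<bbbD> \<and> bounded (f ` \<bbbD>) \<and> (\<forall>z. z \<notin> \<bbbD> \<longrightarrow> f z = 0)}"

definition sup_norm :: "(complex \<Rightarrow> complex) \<Rightarrow> real" where
  "sup_norm f = (SUP z\<in>\<bbbD>. norm (f z))"

definition disc_deriv :: "(complex \<Rightarrow> complex) \<Rightarrow> complex \<Rightarrow> complex" where
  "disc_deriv f = (\<lambda>z. if z \<in> \<bbbD> then deriv f z else 0)"

(* In the following, a normed space is given by its carrier X and its norm N on X. *)

definition unit_ball :: "'a set \<Rightarrow> ('a \<Rightarrow> real) \<Rightarrow> 'a set" where
  "unit_ball X N = {x \<in> X. N x \<le> 1}"

definition fun_norm :: "'a set \<Rightarrow> ('a \<Rightarrow> real) \<Rightarrow> ('a \<Rightarrow> complex) \<Rightarrow> real" where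
  "fun_norm X N \<phi> = (SUP x\<in>unit_ball X N. norm (\<phi> x))"

definition attains_norm :: "'a set \<Rightarrow> ('a \<Rightarrow> real) \<Rightarrow> ('a \<Rightarrow> complex) \<Rightarrow> bool" where
  "attains_norm X N \<phi> \<longleftrightarrow> (\<exists>x\<in>unit_ball X N. norm (\<phi> x) = fun_norm X N \<phi>)"

(* The bounded complex-linear functionals on a normed space of functions.  As for functions on
   the disc, a functional on E is represented by its extension by 0. *)
definition dual :: "(complex \<Rightarrow> complex) set \<Rightarrow> ((complex \<Rightarrow> complex) \<Rightarrow> real)
    \<Rightarrow> ((complex \<Rightarrow> complex) \<Rightarrow> complex) set" where
  "dual E N = {\<phi>.
     (\<forall>f\<in>E. \<forall>g\<in>E. \<phi> (\<lambda>z. f z + g z) = \<phi> f + \<phi> g) \<and>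
     (\<forall>c. \<forall>f\<in>E. \<phi> (\<lambda>z. c * f z) = c * \<phi> f) \<and>
     (\<exists>C. \<forall>f\<in>E. norm (\<phi> f) \<le> C * N f) \<and>
     (\<forall>f. f \<notin> E \<longrightarrow> \<phi> f = 0)}"

definition compact_conv_topology :: "(complex \<Rightarrow> complex) topology" where
  "compact_conv_topology = topology (\<lambda>U. \<forall>f\<in>U. \<exists>K e. compact K \<and> K \<subseteq> \<bbbD> \<and> e > 0 \<and>
     {g. \<forall>z\<in>K. norm (g z - f z) < e} \<subseteq> U)"

(* The predicate above is indeed a topology, so that the use of the constant topology is
   meaningful. *)
lemma openin_compact_conv_topology:
  "openin compact_conv_topology U \<longleftrightarrow> (\<forall>f\<in>U. \<exists>K e. compact K \<and> K \<subseteq> \<bbbD> \<and> e > 0 \<and>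
     {g. \<forall>z\<in>K. norm (g z - f z) < e} \<subseteq> U)"
proof -
  define P where "P f U \<longleftrightarrow> (\<exists>K e. compact K \<and> K \<subseteq> \<bbbD> \<and> e > 0 \<and>
     {g. \<forall>z\<in>K. norm (g z - f z) < e} \<subseteq> U)" for f and U :: "(complex \<Rightarrow> complex) set"
  have mono: "P f V" if "P f U" "U \<subseteq> V" for f U V
    using that unfolding P_def by (meson order_trans)
  have int: "P f (U \<inter> V)" if U: "P f U" and V: "P f V" for f U V
  proof -
    obtain K e where K: "compact K" "K \<subseteq> \<bbbD>" "e > 0" "{g. \<forall>z\<in>K. norm (g z - f z) < e} \<subseteq> U"
      using U unfolding P_def by (elim exE conjE)
    obtain L d where L: "compact L" "L \<subseteq> \<bbbD>" "d > 0" "{g. \<forall>z\<in>L. norm (g z - f z) < d} \<subseteq> V"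
      using V unfolding P_def by (elim exE conjE)
    have "{g. \<forall>z\<in>K \<union> L. norm (g z - f z) < min e d} \<subseteq> U \<inter> V"
      using K(4) L(4) by auto
    then show ?thesis
      unfolding P_def using K L
      by (intro exI[of _ "K \<union> L"] exI[of _ "min e d"] conjI compact_Un Un_least) simp_all
  qed
  have "istopology (\<lambda>U. \<forall>f\<in>U. P f U)"
    unfolding istopology_def
  proof (intro conjI allI impI ballI)
    fix S T f assume "\<forall>f\<in>S. P f S" "\<forall>f\<in>T. P f T" "f \<in> S \<inter> T"
    then show "P f (S \<inter> T)" by (intro int) simp_all
  next
    fix \<K> f assume *: "\<forall>U\<in>\<K>. \<forall>f\<in>U. P f U" "f \<in> \<Union>\<K>"
    then obtain U where U: "U \<in> \<K>" "f \<in> U" by (elim UnionE)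
    with * have "P f U" by simp
    then show "P f (\<Union>\<K>)" by (rule mono) (rule Union_upper[OF U(1)])
  qed
  then have "openin (topology (\<lambda>U. \<forall>f\<in>U. P f U)) U \<longleftrightarrow> (\<forall>f\<in>U. P f U)"
    by (simp only: topology_inverse')
  then show ?thesis
    unfolding compact_conv_topology_def P_def .
qed

definition predual :: "(complex \<Rightarrow> complex) set \<Rightarrow> ((complex \<Rightarrow> complex) \<Rightarrow> real)
    \<Rightarrow> ((complex \<Rightarrow> complex) \<Rightarrow> complex) set" where
  "predual E N = {\<phi> \<in> dual E N.
     continuous_map (subtopology compact_conv_topology (unit_ball E N)) euclidean \<phi>}"

definition G0 :: "((complex \<Rightarrow> complex) \<Rightarrow> complex) set" where
  "G0 = predual HL0 lip_const"

definition Ginf :: "((complex \<Rightarrow> complex) \<Rightarrow> complex) set" where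
  "Ginf = predual Hinf sup_norm"

end

theory Submission
  imports Defs
begin

text \<open>
  Differentiation \<open>f \<mapsto> f'\<close> is a linear isometry of \<open>HL0\<close> onto \<open>Hinf\<close>: on the convex disc the
  mean value inequality identifies the best Lipschitz constant of \<open>f\<close> with the supremum of
  \<open>\<bar>f'\<bar>\<close> (lemma \<open>lipschitz_on_disc_iff\<close>), and every bounded holomorphic function has a
  primitive that vanishes at \<open>0\<close>.  Both this map and its inverse are continuous for uniform
  convergence on compact sets, the map by Cauchy's inequality and the inverse by the mean value
  inequality.

  The predual, its norm and norm attainment of an evaluation \<open>\<phi> \<mapsto> \<phi> f\<close> are defined from
  nothing but the linear structure, the norm and the compact-open topology of the unit ball.  So
  composition with the inverse of an isomorphism of this kind matches the unit balls of the two
  preduals, and the evaluations at \<open>f\<close> and at \<open>f'\<close> take the same values at matching points.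
\<close>

section \<open>Continuity in the compact-open topology\<close>

lemma topspace_compact_conv_topology [simp]: "topspace compact_conv_topology = UNIV"
proof -
  have "openin compact_conv_topology UNIV"
    unfolding openin_compact_conv_topology
    by (auto intro!: exI[of _ "{}"] exI[of _ "1::real"])
  then show ?thesis
    using openin_subset by blast
qed

lemma continuous_map_compact_conv_topologyI:
  assumes "\<And>f K e. \<lbrakk>f \<in> A; compact K; K \<subseteq> \<bbbD>; e > 0\<rbrakk> \<Longrightarrow>
    \<exists>L d. compact L \<and> L \<subseteq> \<bbbD> \<and> d > 0 \<and>
      (\<forall>g\<in>A. (\<forall>z\<in>L. norm (g z - f z) < d) \<longrightarrow> (\<forall>z\<in>K. norm (T g z - T f z) < e))"
  shows "continuous_map (subtopology compact_conv_topology A) compact_conv_topology T"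
  unfolding continuous_map_def
proof (intro conjI allI impI)
  fix U assume U: "openin compact_conv_topology U"
  (* The set {g. norm (g z - f z) < d for all z in L} need not be open, because g may be
     discontinuous.  The set V of all points with such a neighbourhood mapped into U within A is
     open: halving d leaves room for a neighbourhood of each nearby point. *)
  define V where "V = {f. \<exists>L d. compact L \<and> L \<subseteq> \<bbbD> \<and> d > 0 \<and>
    (\<forall>g\<in>A. (\<forall>z\<in>L. norm (g z - f z) < d) \<longrightarrow> T g \<in> U)}"
  have "openin compact_conv_topology V"
    unfolding openin_compact_conv_topology
  proof
    fix f assume "f \<in> V"
    then obtain L d where L: "compact L" "L \<subseteq> \<bbbD>" "d > 0"
      and *: "\<And>g. g \<in> A \<Longrightarrow> (\<forall>z\<in>L. norm (g z - f z) < d) \<Longrightarrow> T g \<in> U"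
      unfolding V_def by blast
    have "g \<in> V" if g: "\<forall>z\<in>L. norm (g z - f z) < d / 2" for g
    proof -
      have "T h \<in> U" if "h \<in> A" and h: "\<forall>z\<in>L. norm (h z - g z) < d / 2" for h
      proof (rule *[OF \<open>h \<in> A\<close>], rule ballI)
        fix z assume z: "z \<in> L"
        have "norm (h z - f z) \<le> norm (h z - g z) + norm (g z - f z)"
          using norm_triangle_ineq[of "h z - g z" "g z - f z"] by simp
        then show "norm (h z - f z) < d"
          using g h z by force
      qed
      then show ?thesis
        unfolding V_def using L half_gt_zero by blast
    qed
    then show "\<exists>K e. compact K \<and> K \<subseteq> \<bbbD> \<and> e > 0 \<and> {g. \<forall>z\<in>K. norm (g z - f z) < e} \<subseteq> V"
      using L half_gt_zero by blast
  qed
  moreover have "{f \<in> A. T f \<in> U} = V \<inter> A"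
  proof (intro equalityI subsetI)
    fix f assume "f \<in> {f \<in> A. T f \<in> U}"
    then have f: "f \<in> A" "T f \<in> U" by auto
    with U obtain K e where K: "compact K" "K \<subseteq> \<bbbD>" "e > 0"
        "{g. \<forall>z\<in>K. norm (g z - T f z) < e} \<subseteq> U"
      unfolding openin_compact_conv_topology by meson
    with assms[OF f(1) K(1-3)] f(1) show "f \<in> V \<inter> A"
      unfolding V_def by blast
  next
    fix f assume f: "f \<in> V \<inter> A"
    then obtain L d where "d > 0"
      and *: "\<And>g. g \<in> A \<Longrightarrow> (\<forall>z\<in>L. norm (g z - f z) < d) \<Longrightarrow> T g \<in> U"
      unfolding V_def by blast
    with *[of f] f show "f \<in> {f \<in> A. T f \<in> U}" by simp
  qed
  ultimately show "openin (subtopology compact_conv_topology A)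
      {f \<in> topspace (subtopology compact_conv_topology A). T f \<in> U}"
    by (auto simp: openin_subtopology)
qed simp

section \<open>Isomorphisms of normed function spaces and norm attainment\<close>

text \<open>
  The inverse \<open>S\<close> is a parameter, so that the assumptions are symmetric and every result also
  holds with the two spaces exchanged.
\<close>

locale function_space_iso =
  fixes E :: "(complex \<Rightarrow> complex) set" and M :: "(complex \<Rightarrow> complex) \<Rightarrow> real"
    and F :: "(complex \<Rightarrow> complex) set" and N :: "(complex \<Rightarrow> complex) \<Rightarrow> real"
    and T S :: "(complex \<Rightarrow> complex) \<Rightarrow> complex \<Rightarrow> complex"
  assumes add_E: "\<And>f g. \<lbrakk>f \<in> E; g \<in> E\<rbrakk> \<Longrightarrow> (\<lambda>z. f z + g z) \<in> E"
    and scale_E: "\<And>c f. f \<in> E \<Longrightarrow> (\<lambda>z. c * f z) \<in> E"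
    and add_F: "\<And>f g. \<lbrakk>f \<in> F; g \<in> F\<rbrakk> \<Longrightarrow> (\<lambda>z. f z + g z) \<in> F"
    and scale_F: "\<And>c f. f \<in> F \<Longrightarrow> (\<lambda>z. c * f z) \<in> F"
    and T_in: "\<And>f. f \<in> E \<Longrightarrow> T f \<in> F"
    and S_in: "\<And>h. h \<in> F \<Longrightarrow> S h \<in> E"
    and S_T: "\<And>f. f \<in> E \<Longrightarrow> S (T f) = f"
    and T_S: "\<And>h. h \<in> F \<Longrightarrow> T (S h) = h"
    and T_add: "\<And>f g. \<lbrakk>f \<in> E; g \<in> E\<rbrakk> \<Longrightarrow> T (\<lambda>z. f z + g z) = (\<lambda>z. T f z + T g z)"
    and T_scale: "\<And>c f. f \<in> E \<Longrightarrow> T (\<lambda>z. c * f z) = (\<lambda>z. c * T f z)"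
    and norm_T: "\<And>f. f \<in> E \<Longrightarrow> N (T f) = M f"
    and continuous_T: "continuous_map (subtopology compact_conv_topology (unit_ball E M))
      compact_conv_topology T"
    and continuous_S: "continuous_map (subtopology compact_conv_topology (unit_ball F N))
      compact_conv_topology S"
begin

lemma S_add: "S (\<lambda>z. g z + h z) = (\<lambda>z. S g z + S h z)" if "g \<in> F" "h \<in> F"
  using that S_T[OF add_E[OF S_in S_in]] by (simp add: T_add S_in T_S)

lemma S_scale: "S (\<lambda>z. c * h z) = (\<lambda>z. c * S h z)" if "h \<in> F"
  using that S_T[OF scale_E[OF S_in]] by (simp add: T_scale S_in T_S)

lemma norm_S: "M (S h) = N h" if "h \<in> F"
  using that norm_T[OF S_in] by (simp add: T_S)

lemma inverse_iso: "function_space_iso F N E M S T"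
  by unfold_locales
    (auto simp: add_E scale_E add_F scale_F T_in S_in S_T T_S S_add S_scale norm_S
       continuous_T continuous_S)

lemma S_image_unit_ball: "S ` unit_ball F N = unit_ball E M"
proof
  show "S ` unit_ball F N \<subseteq> unit_ball E M"
    by (auto simp: unit_ball_def S_in norm_S)
  show "unit_ball E M \<subseteq> S ` unit_ball F N"
  proof
    fix f assume "f \<in> unit_ball E M"
    then have "T f \<in> unit_ball F N" "f = S (T f)"
      by (simp_all add: unit_ball_def T_in norm_T S_T)
    then show "f \<in> S ` unit_ball F N" by blast
  qed
qed

text \<open>The transpose of \<open>S\<close>, extended by \<open>0\<close> outside \<open>F\<close> as required by the encoding of \<open>dual\<close>.\<close>

definition transport :: "((complex \<Rightarrow> complex) \<Rightarrow> complex) \<Rightarrow> (complex \<Rightarrow> complex) \<Rightarrow> complex" where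
  "transport \<phi> = (\<lambda>h. if h \<in> F then \<phi> (S h) else 0)"

lemma fun_norm_transport: "fun_norm F N (transport \<phi>) = fun_norm E M \<phi>"
proof -
  have "(\<lambda>h. norm (transport \<phi> h)) ` unit_ball F N = (\<lambda>f. norm (\<phi> f)) ` S ` unit_ball F N"
    unfolding image_image by (rule image_cong) (auto simp: transport_def unit_ball_def)
  then show ?thesis
    by (simp add: fun_norm_def S_image_unit_ball)
qed

lemma transport_in_predual:
  assumes "\<phi> \<in> predual E M"
  shows "transport \<phi> \<in> predual F N"
proof -
  have add: "\<phi> (\<lambda>z. f z + g z) = \<phi> f + \<phi> g" if "f \<in> E" "g \<in> E" for f g
    using assms that by (auto simp: predual_def dual_def)
  have scale: "\<phi> (\<lambda>z. c * f z) = c * \<phi> f" if "f \<in> E" for c f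
    using assms that by (auto simp: predual_def dual_def)
  obtain C where C: "\<forall>f\<in>E. norm (\<phi> f) \<le> C * M f"
    using assms by (auto simp: predual_def dual_def)
  have "\<forall>h\<in>F. norm (transport \<phi> h) \<le> C * N h"
    using C S_in norm_S by (metis transport_def)
  then have "transport \<phi> \<in> dual F N"
    by (auto simp: dual_def transport_def add_F scale_F S_add S_scale S_in add scale)
  moreover have "continuous_map (subtopology compact_conv_topology (unit_ball F N)) euclidean
      (transport \<phi>)"
  proof (rule continuous_map_eq)
    have "continuous_map (subtopology compact_conv_topology (unit_ball F N))
        (subtopology compact_conv_topology (unit_ball E M)) S"
      using continuous_S S_image_unit_ball by (auto simp: continuous_map_in_subtopology)
    moreover have "continuous_map (subtopology compact_conv_topology (unit_ball E M)) euclidean \<phi>"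
      using assms by (simp add: predual_def)
    ultimately show "continuous_map (subtopology compact_conv_topology (unit_ball F N))
        euclidean (\<phi> \<circ> S)"
      by (rule continuous_map_compose)
  qed (auto simp: transport_def unit_ball_def)
  ultimately show ?thesis
    by (simp add: predual_def)
qed

lemma evaluation_values_subset:
  assumes "f \<in> E"
  shows "(\<lambda>\<phi>. norm (\<phi> f)) ` unit_ball (predual E M) (fun_norm E M) \<subseteq>
    (\<lambda>\<psi>. norm (\<psi> (T f))) ` unit_ball (predual F N) (fun_norm F N)"
proof (intro image_subsetI)
  fix \<phi> assume \<phi>: "\<phi> \<in> unit_ball (predual E M) (fun_norm E M)"
  have "transport \<phi> (T f) = \<phi> f"
    using assms by (simp add: transport_def T_in S_T)
  moreover have "transport \<phi> \<in> unit_ball (predual F N) (fun_norm F N)"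
    using \<phi> by (simp add: unit_ball_def transport_in_predual fun_norm_transport)
  ultimately show "norm (\<phi> f) \<in> (\<lambda>\<psi>. norm (\<psi> (T f))) ` unit_ball (predual F N) (fun_norm F N)"
    by (metis rev_image_eqI)
qed

end

text \<open>Norm attainment depends only on the set of values that the functional has on the unit ball.\<close>

lemma attains_norm_iff_SUP_mem:
  "attains_norm X N \<phi> \<longleftrightarrow>
    (SUP x\<in>unit_ball X N. norm (\<phi> x)) \<in> (\<lambda>x. norm (\<phi> x)) ` unit_ball X N"
  unfolding attains_norm_def fun_norm_def image_iff by (simp add: eq_commute)

theorem (in function_space_iso) attains_norm_evaluation_iff:
  assumes "f \<in> E"
  shows "attains_norm (predual E M) (fun_norm E M) (\<lambda>\<phi>. \<phi> f) \<longleftrightarrow>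
    attains_norm (predual F N) (fun_norm F N) (\<lambda>\<psi>. \<psi> (T f))"
proof -
  interpret inv: function_space_iso F N E M S T
    by (rule inverse_iso)
  have "(\<lambda>\<phi>. norm (\<phi> f)) ` unit_ball (predual E M) (fun_norm E M) =
      (\<lambda>\<psi>. norm (\<psi> (T f))) ` unit_ball (predual F N) (fun_norm F N)"
    using evaluation_values_subset[OF assms] inv.evaluation_values_subset[OF T_in[OF assms]]
    by (simp add: S_T[OF assms] subset_antisym)
  then show ?thesis
    by (simp add: attains_norm_iff_SUP_mem)
qed

section \<open>Lipschitz constants and derivatives\<close>

lemma has_field_derivative_deriv_disc:
  assumes "f holomorphic_on \<bbbD>" "z \<in> \<bbbD>"
  shows "(f has_field_derivative deriv f z) (at z)"
  using assms by (intro holomorphic_derivI) auto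

text \<open>
  The derivative is a limit of difference quotients; conversely, the mean value inequality applies
  because the disc is convex.
\<close>

lemma lipschitz_on_disc_iff:
  assumes "f holomorphic_on \<bbbD>"
  shows "L-lipschitz_on \<bbbD> f \<longleftrightarrow> (\<forall>z\<in>\<bbbD>. norm (deriv f z) \<le> L)"
proof (intro iffI ballI)
  fix z assume L: "L-lipschitz_on \<bbbD> f" and z: "z \<in> \<bbbD>"
  have "((\<lambda>w. norm ((f w - f z) / (w - z))) \<longlongrightarrow> norm (deriv f z)) (at z)"
    using has_field_derivative_deriv_disc[OF assms z]
    by (intro tendsto_norm) (simp add: has_field_derivative_iff)
  moreover have "eventually (\<lambda>w. w \<in> \<bbbD> \<and> w \<noteq> z) (at z)"
    using eventually_at_in_open[of \<bbbD> z] z by (auto elim: eventually_mono)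
  then have "eventually (\<lambda>w. norm ((f w - f z) / (w - z)) \<le> L) (at z)"
  proof eventually_elim
    case (elim w)
    then show ?case
      using lipschitz_on_normD[OF L, of w z] z by (simp add: norm_divide divide_simps)
  qed
  ultimately show "norm (deriv f z) \<le> L"
    by (rule tendsto_upperbound) simp
next
  assume L: "\<forall>z\<in>\<bbbD>. norm (deriv f z) \<le> L"
  show "L-lipschitz_on \<bbbD> f"
  proof (rule lipschitz_onI)
    fix z w assume "z \<in> \<bbbD>" "w \<in> \<bbbD>"
    then show "dist (f z) (f w) \<le> L * dist z w"
      unfolding dist_norm
      using L has_field_derivative_deriv_disc[OF assms]
      by (intro field_differentiable_bound[of \<bbbD> f "deriv f"])
        (auto intro: has_field_derivative_at_within)
  next
    have "norm (deriv f 0) \<le> L" using L by simp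
    then show "0 \<le> L" using norm_ge_zero order_trans by blast
  qed
qed

lemma lip_const_le_iff:
  assumes "C-lipschitz_on \<bbbD> f"
  shows "lip_const f \<le> L \<longleftrightarrow> L-lipschitz_on \<bbbD> f"
proof -
  let ?P = "{(z, w). z \<in> \<bbbD> \<and> w \<in> \<bbbD> \<and> z \<noteq> w}"
  have quotient: "norm (f z - f w) / norm (z - w) \<le> B"
    if "B-lipschitz_on \<bbbD> f" "z \<in> \<bbbD>" "w \<in> \<bbbD>" "z \<noteq> w" for B z w
    using lipschitz_on_normD[OF that(1-3)] that(4) by (simp add: divide_simps)
  have ne: "(0, 1/2) \<in> ?P"
    by simp
  have "lip_const f \<le> L \<longleftrightarrow>
      (\<forall>(z, w)\<in>?P. norm (f z - f w) / norm (z - w) \<le> L)"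
    unfolding lip_const_def
  proof (subst cSUP_le_iff)
    show "bdd_above ((\<lambda>(z, w). norm (f z - f w) / norm (z - w)) ` ?P)"
      using quotient[OF assms] by (auto intro!: bdd_aboveI2[where M = C])
    show "?P \<noteq> {}" using ne by blast
  qed (simp add: case_prod_unfold)
  also have "\<dots> \<longleftrightarrow> L-lipschitz_on \<bbbD> f"
  proof
    assume L: "\<forall>(z, w)\<in>?P. norm (f z - f w) / norm (z - w) \<le> L"
    have "norm (f 0 - f (1/2)) / norm (0 - 1/2 :: complex) \<le> L"
      using L ne by blast
    then have "0 \<le> L"
      by (rule order_trans[rotated]) simp
    moreover have "norm (f z - f w) \<le> L * norm (z - w)" if "z \<in> \<bbbD>" "w \<in> \<bbbD>" for z w
      using L that by (cases "z = w") (auto simp: divide_simps split: if_splits)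
    ultimately show "L-lipschitz_on \<bbbD> f"
      by (auto intro: lipschitz_onI simp: dist_norm)
  qed (use quotient in auto)
  finally show ?thesis .
qed

lemma sup_norm_le_iff:
  assumes "bounded (h ` \<bbbD>)"
  shows "sup_norm h \<le> L \<longleftrightarrow> (\<forall>z\<in>\<bbbD>. norm (h z) \<le> L)"
  unfolding sup_norm_def
proof (rule cSUP_le_iff)
  show "bdd_above ((\<lambda>z. norm (h z)) ` \<bbbD>)"
    using assms by (auto simp: bounded_iff bdd_above_def)
qed simp

text \<open>
  In this form, stability under linear combinations with complex coefficients is immediate from
  the linearity of \<open>deriv\<close>.
\<close>

lemma HL0_iff:
  "f \<in> HL0 \<longleftrightarrow> f holomorphic_on \<bbbD> \<and> bounded (deriv f ` \<bbbD>) \<and> f 0 = 0 \<and> (\<forall>z. z \<notin> \<bbbD> \<longrightarrow> f z = 0)"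
proof -
  have "(\<exists>C. C-lipschitz_on \<bbbD> f) \<longleftrightarrow> bounded (deriv f ` \<bbbD>)" if "f holomorphic_on \<bbbD>"
    using that by (simp only: lipschitz_on_disc_iff bounded_iff ball_simps)
  then show ?thesis
    by (auto simp: HL0_def)
qed

section \<open>Differentiation as an isomorphism\<close>

lemma bounded_disc_deriv_iff: "bounded (disc_deriv f ` \<bbbD>) \<longleftrightarrow> bounded (deriv f ` \<bbbD>)"
  by (simp add: bounded_iff disc_deriv_def)

lemma disc_deriv_in_Hinf:
  assumes "f \<in> HL0"
  shows "disc_deriv f \<in> Hinf"
proof -
  have "deriv f holomorphic_on \<bbbD>"
    using assms by (simp add: HL0_iff holomorphic_deriv)
  then have "disc_deriv f holomorphic_on \<bbbD>"
    by (rule holomorphic_transform) (simp add: disc_deriv_def)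
  then show ?thesis
    using assms by (auto simp: Hinf_def HL0_iff bounded_disc_deriv_iff) (simp add: disc_deriv_def)
qed

lemma sup_norm_disc_deriv:
  assumes "f \<in> HL0"
  shows "sup_norm (disc_deriv f) = lip_const f"
proof -
  obtain C where C: "C-lipschitz_on \<bbbD> f" and hol: "f holomorphic_on \<bbbD>"
    using assms by (auto simp: HL0_def)
  have "bounded (disc_deriv f ` \<bbbD>)"
    using disc_deriv_in_Hinf[OF assms] by (simp add: Hinf_def)
  then have "sup_norm (disc_deriv f) \<le> L \<longleftrightarrow> lip_const f \<le> L" for L
    using C hol by (simp add: sup_norm_le_iff lip_const_le_iff lipschitz_on_disc_iff disc_deriv_def)
  then show ?thesis
    by (meson order_antisym order_refl)
qed

lemma deriv_add_disc:
  assumes "f holomorphic_on \<bbbD>" "g holomorphic_on \<bbbD>" "z \<in> \<bbbD>"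
  shows "deriv (\<lambda>z. f z + g z) z = deriv f z + deriv g z"
  using assms by (intro deriv_add) (auto intro: holomorphic_on_imp_differentiable_at)

lemma deriv_cmult_disc:
  assumes "f holomorphic_on \<bbbD>" "z \<in> \<bbbD>"
  shows "deriv (\<lambda>z. c * f z) z = c * deriv f z"
  using assms by (intro deriv_cmult) (auto intro: holomorphic_on_imp_differentiable_at)

lemma bounded_image_cmult:
  fixes f :: "'a \<Rightarrow> complex"
  assumes "bounded (f ` A)"
  shows "bounded ((\<lambda>z. c * f z) ` A)"
  using bounded_linear_image[OF assms bounded_linear_mult_right[of c]] by (simp add: image_image)

lemma HL0_add: "(\<lambda>z. f z + g z) \<in> HL0" if "f \<in> HL0" "g \<in> HL0"
proof -
  have "deriv (\<lambda>z. f z + g z) ` \<bbbD> = (\<lambda>z. deriv f z + deriv g z) ` \<bbbD>"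
    using that by (intro image_cong) (auto simp: HL0_iff deriv_add_disc)
  then show ?thesis
    using that by (auto simp: HL0_iff bounded_plus_comp intro: holomorphic_on_add)
qed

lemma HL0_cmult: "(\<lambda>z. c * f z) \<in> HL0" if "f \<in> HL0"
proof -
  have "deriv (\<lambda>z. c * f z) ` \<bbbD> = (\<lambda>z. c * deriv f z) ` \<bbbD>"
    using that by (intro image_cong) (auto simp: HL0_iff deriv_cmult_disc)
  then show ?thesis
    using that by (auto simp: HL0_iff bounded_image_cmult intro: holomorphic_on_mult)
qed

lemma Hinf_add: "(\<lambda>z. f z + g z) \<in> Hinf" if "f \<in> Hinf" "g \<in> Hinf"
  using that by (auto simp: Hinf_def bounded_plus_comp intro: holomorphic_on_add)

lemma Hinf_cmult: "(\<lambda>z. c * f z) \<in> Hinf" if "f \<in> Hinf"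
  using that by (auto simp: Hinf_def bounded_image_cmult intro: holomorphic_on_mult)

lemma bij_betw_disc_deriv: "bij_betw disc_deriv HL0 Hinf"
  unfolding bij_betw_def
proof (intro conjI equalityI)
  show "inj_on disc_deriv HL0"
  proof (rule inj_onI, rule ext)
    fix f g z assume f: "f \<in> HL0" and g: "g \<in> HL0" and eq: "disc_deriv f = disc_deriv g"
    show "f z = g z"
    proof (cases "z \<in> \<bbbD>")
      case True
      have "((\<lambda>z. f z - g z) has_field_derivative 0) (at w within \<bbbD>)" if "w \<in> \<bbbD>" for w
      proof -
        have "deriv f w = deriv g w"
          using fun_cong[OF eq, of w] that by (simp add: disc_deriv_def)
        then show ?thesis
          using f g that
            DERIV_diff[OF has_field_derivative_deriv_disc has_field_derivative_deriv_disc, of f w g]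
          by (auto simp: HL0_iff intro: has_field_derivative_at_within)
      qed
      then obtain c where "\<And>w. w \<in> \<bbbD> \<Longrightarrow> f w - g w = c"
        using has_field_derivative_zero_constant[of \<bbbD> "\<lambda>z. f z - g z"] by auto
      from this[of z] this[of 0] show ?thesis
        using True f g by (simp add: HL0_iff)
    qed (use f g in \<open>simp add: HL0_iff\<close>)
  qed
  show "disc_deriv ` HL0 \<subseteq> Hinf"
    using disc_deriv_in_Hinf by blast
  show "Hinf \<subseteq> disc_deriv ` HL0"
  proof
    fix h assume h: "h \<in> Hinf"
    then have "h holomorphic_on \<bbbD>"
      by (simp add: Hinf_def)
    then obtain p where p: "\<And>z. z \<in> \<bbbD> \<Longrightarrow> (p has_field_derivative h z) (at z within \<bbbD>)"
      using holomorphic_convex_primitive'[OF convex_ball open_ball] by metis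
    define f where "f = (\<lambda>z. if z \<in> \<bbbD> then p z - p 0 else 0)"
    have f: "(f has_field_derivative h z) (at z)" if "z \<in> \<bbbD>" for z
    proof (rule has_field_derivative_transform_within_open[where S = \<bbbD>])
      have "(p has_field_derivative h z) (at z)"
        using p[OF that] at_within_open[OF that open_ball] by simp
      then show "((\<lambda>z. p z - p 0) has_field_derivative h z) (at z)"
        by (auto intro!: derivative_eq_intros)
    qed (use that in \<open>auto simp: f_def\<close>)
    then have eq: "disc_deriv f = h"
      using h by (auto simp: disc_deriv_def Hinf_def DERIV_imp_deriv)
    have "f holomorphic_on \<bbbD>"
      using f unfolding holomorphic_on_open[OF open_ball] by blast
    moreover have "bounded (deriv f ` \<bbbD>)"
      using h unfolding bounded_disc_deriv_iff[symmetric] eq by (simp add: Hinf_def)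
    ultimately have "f \<in> HL0"
      by (auto simp: HL0_iff f_def)
    with eq show "h \<in> disc_deriv ` HL0" by blast
  qed
qed

text \<open>
  Closed discs of one radius \<open>r\<close> about all points of \<open>K\<close> fit into \<open>\<bbbD>\<close>, so Cauchy's inequality
  bounds the derivative on \<open>K\<close> by the function on the compact union of these discs.
\<close>

lemma continuous_map_disc_deriv:
  "continuous_map (subtopology compact_conv_topology (unit_ball HL0 lip_const))
    compact_conv_topology disc_deriv"
proof (rule continuous_map_compact_conv_topologyI)
  fix f K and e :: real
  assume "f \<in> unit_ball HL0 lip_const" and K: "compact K" "K \<subseteq> \<bbbD>" and e: "e > 0"
  then have f: "f holomorphic_on \<bbbD>" by (simp add: unit_ball_def HL0_iff)
  obtain r where r: "r > 0" and sub: "(\<Union>z\<in>K. cball z r) \<subseteq> \<bbbD>"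
    using compact_subset_open_imp_cball_epsilon_subset[OF K(1) open_ball K(2)] .
  have "norm (disc_deriv g z - disc_deriv f z) < e"
    if "g \<in> unit_ball HL0 lip_const" and z: "z \<in> K"
      and close: "\<forall>w\<in>(\<Union>z\<in>K. cball z r). norm (g w - f w) < e * r / 2" for g z
  proof -
    have g: "g holomorphic_on \<bbbD>" using that(1) by (simp add: unit_ball_def HL0_iff)
    have cball: "cball z r \<subseteq> \<bbbD>" using sub z by blast
    have hol: "(\<lambda>w. g w - f w) holomorphic_on \<bbbD>"
      using f g by (rule holomorphic_on_diff[rotated])
    have "norm ((deriv ^^ 1) (\<lambda>w. g w - f w) z) \<le> fact 1 * (e * r / 2) / r ^ 1"
    proof (rule Cauchy_inequality[OF _ _ r])
      show "(\<lambda>w. g w - f w) holomorphic_on ball z r"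
        using hol cball ball_subset_cball by (meson holomorphic_on_subset order_trans)
      show "continuous_on (cball z r) (\<lambda>w. g w - f w)"
        using hol cball by (meson holomorphic_on_imp_continuous_on continuous_on_subset)
      fix w assume "norm (z - w) = r"
      then have "w \<in> (\<Union>z\<in>K. cball z r)"
        using z by (auto simp: dist_norm)
      then show "norm (g w - f w) \<le> e * r / 2"
        using close less_imp_le by blast
    qed
    also have "\<dots> < e" using e r by simp
    finally have "norm (deriv (\<lambda>w. g w - f w) z) < e" by simp
    moreover have "deriv (\<lambda>w. g w - f w) z = deriv g z - deriv f z"
      using f g z K(2)
      by (intro deriv_diff) (auto intro!: holomorphic_on_imp_differentiable_at[of _ \<bbbD>])
    ultimately show ?thesis
      using z K(2) by (auto simp: disc_deriv_def)
  qed
  moreover have "compact (\<Union>z\<in>K. cball z r)"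
    using K(1) by (rule compact_minkowski_sum_cball)
  ultimately show "\<exists>L d. compact L \<and> L \<subseteq> \<bbbD> \<and> d > 0 \<and> (\<forall>g\<in>unit_ball HL0 lip_const.
      (\<forall>z\<in>L. norm (g z - f z) < d) \<longrightarrow> (\<forall>z\<in>K. norm (disc_deriv g z - disc_deriv f z) < e))"
    using sub e r by (intro exI[of _ "\<Union>z\<in>K. cball z r"] exI[of _ "e * r / 2"]) auto
qed

text \<open>
  If the derivatives are close on the compact convex set spanned by \<open>K\<close> and the base point \<open>0\<close>,
  then so are the functions on \<open>K\<close>, since they agree at \<open>0\<close>.
\<close>

lemma continuous_map_inv_disc_deriv:
  "continuous_map (subtopology compact_conv_topology (unit_ball Hinf sup_norm))
    compact_conv_topology (inv_into HL0 disc_deriv)"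
proof (rule continuous_map_compact_conv_topologyI)
  let ?S = "inv_into HL0 disc_deriv"
  fix h K and e :: real
  assume h: "h \<in> unit_ball Hinf sup_norm" and K: "compact K" "K \<subseteq> \<bbbD>" and e: "e > 0"
  define L where "L = convex hull (insert 0 K)"
  have L: "compact L" "convex L" "0 \<in> L" "K \<subseteq> L"
    using K(1) hull_subset[of "insert 0 K" convex]
    by (auto simp: L_def intro: compact_convex_hull)
  have LD: "L \<subseteq> \<bbbD>"
    unfolding L_def using K(2) by (intro hull_minimal) auto
  have S: "?S k \<in> HL0" "\<And>w. w \<in> \<bbbD> \<Longrightarrow> (?S k has_field_derivative k w) (at w)"
    if "k \<in> unit_ball Hinf sup_norm" for k
  proof -
    have k: "k \<in> disc_deriv ` HL0"
      using that bij_betw_disc_deriv by (simp add: unit_ball_def bij_betw_def)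
    then show in_HL0: "?S k \<in> HL0"
      by (rule inv_into_into)
    fix w assume w: "w \<in> \<bbbD>"
    have "deriv (?S k) w = k w"
      using fun_cong[OF f_inv_into_f[OF k], of w] w by (simp add: disc_deriv_def)
    then show "(?S k has_field_derivative k w) (at w)"
      using has_field_derivative_deriv_disc[OF _ w, of "?S k"] in_HL0 by (simp add: HL0_iff)
  qed
  have "norm (?S g z - ?S h z) < e"
    if g: "g \<in> unit_ball Hinf sup_norm" and close: "\<forall>w\<in>L. norm (g w - h w) < e" and z: "z \<in> K"
    for g z
  proof -
    have "norm ((?S g z - ?S h z) - (?S g 0 - ?S h 0)) \<le> e * norm (z - 0)"
    proof (rule field_differentiable_bound[OF L(2)])
      fix w assume w: "w \<in> L"
      then have "w \<in> \<bbbD>" using LD by blast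
      then show "((\<lambda>w. ?S g w - ?S h w) has_field_derivative g w - h w) (at w within L)"
        using DERIV_diff[OF S(2)[OF g] S(2)[OF h]] by (blast intro: has_field_derivative_at_within)
      show "norm (g w - h w) \<le> e" using close w by (simp add: less_imp_le)
    qed (use L z in auto)
    also have "\<dots> < e"
      using e z K(2) by auto
    finally show ?thesis
      using S(1)[OF g] S(1)[OF h] by (simp add: HL0_iff)
  qed
  then show "\<exists>L d. compact L \<and> L \<subseteq> \<bbbD> \<and> d > 0 \<and> (\<forall>g\<in>unit_ball Hinf sup_norm.
      (\<forall>z\<in>L. norm (g z - h z) < d) \<longrightarrow> (\<forall>z\<in>K. norm (?S g z - ?S h z) < e))"
    using L(1) LD e by blast
qed

lemma function_space_iso_disc_deriv:
  "function_space_iso HL0 lip_const Hinf sup_norm disc_deriv (inv_into HL0 disc_deriv)"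
proof
  fix f g h :: "complex \<Rightarrow> complex" and c
  show "disc_deriv (\<lambda>z. f z + g z) = (\<lambda>z. disc_deriv f z + disc_deriv g z)"
    if "f \<in> HL0" "g \<in> HL0"
    using that by (auto simp: disc_deriv_def HL0_iff deriv_add_disc)
  show "disc_deriv (\<lambda>z. c * f z) = (\<lambda>z. c * disc_deriv f z)" if "f \<in> HL0"
    using that by (auto simp: disc_deriv_def HL0_iff deriv_cmult_disc)
  show "inv_into HL0 disc_deriv h \<in> HL0" if "h \<in> Hinf"
    using that bij_betw_disc_deriv by (metis bij_betw_def inv_into_into)
  show "inv_into HL0 disc_deriv (disc_deriv f) = f" if "f \<in> HL0"
    using that bij_betw_disc_deriv by (metis bij_betw_inv_into_left)
  show "disc_deriv (inv_into HL0 disc_deriv h) = h" if "h \<in> Hinf"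
    using that bij_betw_disc_deriv by (metis bij_betw_inv_into_right)
qed (fact HL0_add HL0_cmult Hinf_add Hinf_cmult disc_deriv_in_Hinf sup_norm_disc_deriv
      continuous_map_disc_deriv continuous_map_inv_disc_deriv)+

theorem corollary2p11:
  fixes f :: "complex \<Rightarrow> complex"
  assumes "f \<in> HL0"
  shows "disc_deriv f \<in> Hinf \<and>
    (attains_norm G0 (fun_norm HL0 lip_const) (\<lambda>\<phi>. \<phi> f) \<longleftrightarrow>
     attains_norm Ginf (fun_norm Hinf sup_norm) (\<lambda>\<phi>. \<phi> (disc_deriv f)))"
  unfolding G0_def Ginf_def
  using disc_deriv_in_Hinf[OF assms]
    function_space_iso.attains_norm_evaluation_iff[OF function_space_iso_disc_deriv assms]
  by blast

end
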